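(* Let $\mathbb{F}$ be a finite field, let $G$ be a finite simple graph, and let $H$ be the underlying graph of the line digraph $\delta G$. Then $\xi_{\mathbb{F}}(H)\geq \sqrt{\log_{|\mathbb{F}|}\chi(G)}$.
   Context: For $x,y\in\mathbb{F}^k$, $\langle x,y\rangle=\sum_i x_iy_i$ over $\mathbb{F}$. A $k$-dimensional orthogonal representation of a graph $G=(V,E)$ over $\mathbb{F}$ assigns to each $v\in V$ a vector $u_v\in\mathbb{F}^k$ with $\langle u_v,u_v\rangle\neq0$ such that $\langle u_v,u_{v'}\rangle=0$ whenever $v,v'$ are adjacent. The orthogonality dimension $\xi_{\mathbb{F}}(G)$ is the smallest $k$ for which such a representation exists. $\chi$ denotes the chromatic number. The line digraph $\delta G$ of a graph $G$ (each edge viewed as two opposite directed edges) has as vertices all ordered pairs $(x,y)$ with $\{x,y\}$ an edge of $G$, with a directed edge from $(x,y)$ to $(z,w)$ whenever $y=z$; its underlying graph $H$ is obtained by ignoring directions. *)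

theory Defs
  imports
    Complex_Main
    "HOL-Library.Cardinality"
    "Graph_Theory.Graph_Theory"
    "Jordan_Normal_Form.Matrix"
begin

(* Finite simple graphs are Graph_Theory's pair_graph: a finite vertex set pverts G together
   with a symmetric irreflexive adjacency relation parcs G, so that an edge {x,y} is
   represented by the two arcs (x,y) and (y,x). *)

definition proper_coloring :: "'a pair_pre_digraph \<Rightarrow> nat \<Rightarrow> ('a \<Rightarrow> nat) \<Rightarrow> bool" where
  "proper_coloring G n c \<longleftrightarrow>
     (\<forall>v \<in> pverts G. c v < n) \<and> (\<forall>(v, w) \<in> parcs G. c v \<noteq> c w)"

definition chromatic_number :: "'a pair_pre_digraph \<Rightarrow> nat" where
  "chromatic_number G = (LEAST n. \<exists>c. proper_coloring G n c)"

definition orthogonal_representation ::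
  "'a pair_pre_digraph \<Rightarrow> nat \<Rightarrow> ('a \<Rightarrow> 'f::field vec) \<Rightarrow> bool" where
  "orthogonal_representation G k u \<longleftrightarrow>
     (\<forall>v \<in> pverts G. u v \<in> carrier_vec k \<and> u v \<bullet> u v \<noteq> 0) \<and>
     (\<forall>(v, w) \<in> parcs G. u v \<bullet> u w = 0)"

definition orthogonality_dimension :: "'f::field itself \<Rightarrow> 'a pair_pre_digraph \<Rightarrow> nat" where
  "orthogonality_dimension _ G =
     (LEAST k. \<exists>u :: 'a \<Rightarrow> 'f vec. orthogonal_representation G k u)"

(* For a symmetric G the set parcs G consists exactly of the ordered pairs (x,y) with {x,y}
   an edge of G. *)
definition line_digraph :: "'a pair_pre_digraph \<Rightarrow> ('a \<times> 'a) pair_pre_digraph" where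
  "line_digraph G =
     \<lparr> pverts = parcs G,
       parcs = {((x, y), (z, w)) | x y z w. (x, y) \<in> parcs G \<and> (z, w) \<in> parcs G \<and> y = z} \<rparr>"

definition underlying_line_graph :: "'a pair_pre_digraph \<Rightarrow> ('a \<times> 'a) pair_pre_digraph" where
  "underlying_line_graph G = mk_symmetric (with_proj (line_digraph G))"

lemma pair_graph_underlying_line_graph:
  assumes "pair_graph G"
  shows "pair_graph (underlying_line_graph G)"
proof -
  interpret G: pair_graph G by fact
  have fin: "finite (parcs (line_digraph G))"
    by (rule finite_subset[of _ "parcs G \<times> parcs G"]) (auto simp: line_digraph_def)
  have "pair_digraph (line_digraph G)"
    using G.pair_finite_arcs fin G.pair_no_loops
    by unfold_locales (auto simp: line_digraph_def)
  then interpret L: pair_digraph "line_digraph G" .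
  interpret H: pair_digraph "underlying_line_graph G"
    unfolding underlying_line_graph_def by (rule L.digraph_mk_symmetric)
  show ?thesis
    by unfold_locales (simp add: underlying_line_graph_def symmetric_mk_symmetric)
qed

(* The two minima above range over nonempty sets. *)

lemma proper_coloring_exists:
  assumes "pair_graph G"
  shows "\<exists>n c. proper_coloring G n c"
proof -
  interpret G: pair_graph G by fact
  obtain c and n :: nat where c: "c ` pverts G = {i. i < n}" "inj_on c (pverts G)"
    using finite_imp_inj_to_nat_seg[OF G.pair_finite_verts] by blast
  have "proper_coloring G n c"
    unfolding proper_coloring_def
    using c G.pair_no_loops G.wellformed' by (fastforce dest: inj_onD)
  then show ?thesis by blast
qed

lemma orthogonal_representation_exists:
  assumes "pair_graph G"
  shows "\<exists>k (u :: 'a \<Rightarrow> 'f::field vec). orthogonal_representation (G :: 'a pair_pre_digraph) k u"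
proof -
  interpret G: pair_graph G by fact
  obtain n c where c: "proper_coloring G n c" using proper_coloring_exists[OF assms] by blast
  have "orthogonal_representation G n (\<lambda>v. unit_vec n (c v) :: 'f vec)"
    using c G.wellformed'
    by (fastforce simp: orthogonal_representation_def proper_coloring_def)
  then show ?thesis by blast
qed

end

theory Submission
  imports Defs "Jordan_Normal_Form.VS_Connect"
begin

text \<open>
  Colour a vertex \<open>x\<close> of \<open>G\<close> by the orthogonal complement in \<open>\<F>\<^sup>k\<close> of the vectors assigned to
  the arcs leaving \<open>x\<close>. For an arc \<open>(x, y)\<close> the vector of \<open>(x, y)\<close> is orthogonal to every
  vector of an arc leaving \<open>y\<close> but not to itself, so \<open>x\<close> and \<open>y\<close> get different colours. An
  orthogonal complement is determined by \<open>k\<close> vectors, so at most \<open>q ^ (k * k)\<close> colours occur.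
\<close>

text \<open>A vector of \<open>S\<close> outside \<open>span U\<close> could be adjoined to
  \<open>U\<close> without losing independence, against maximality; hence \<open>S\<close> lies in
  \<open>span U\<close>.\<close>

lemma (in vec_space) maximal_lin_indpt_subset_span:
  assumes S: "S \<subseteq> carrier_vec n" and max: "maximal U (\<lambda>T. T \<subseteq> S \<and> lin_indpt T)"
  shows "span U = span S"
proof
  have U: "U \<subseteq> S" "lin_indpt U" using max by (auto simp: maximal_def)
  show "span U \<subseteq> span S" by (rule span_is_monotone[OF U(1)])
  have Uc: "U \<subseteq> carrier_vec n" using U(1) S by blast
  have "s \<in> span U" if s: "s \<in> S" for s
  proof (rule ccontr)
    assume ns: "s \<notin> span U"
    have sU: "s \<notin> U" using ns in_own_span[OF Uc] by blast
    have "lin_indpt (U \<union> {s})"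
      using lin_dep_iff_in_span[of U s] Uc U(2) s S sU ns by auto
    then have "U \<union> {s} = U"
      using max U(1) s unfolding maximal_def by blast
    then show False using sU by blast
  qed
  then show "span S \<subseteq> span U"
    using span_is_subset[OF _ span_is_submodule[OF Uc]] by blast
qed

text \<open>An orthogonal complement depends only on the span, so a maximal independent subset of
  \<open>S\<close> already determines it. Lists of the fixed length \<open>n\<close> make the
  complements easy to count.\<close>

lemma (in vec_space) orthogonal_complement_of_list:
  fixes S :: "'a vec set"
  assumes S: "S \<subseteq> carrier_vec n"
  obtains vs where "set vs \<subseteq> carrier_vec n" "length vs = n"
    "orthogonal_complement (set vs) = orthogonal_complement S"
proof -
  have "\<exists>U. finite U \<and> maximal U (\<lambda>T. T \<subseteq> S \<and> lin_indpt T)"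
  \<comment> \<open>Independent sets have at most \<open>n\<close> elements, so a maximal one exists
    even if \<open>S\<close> is infinite.\<close>
  proof (rule maximal_exists)
    show "finite A \<and> card A \<le> n" if "A \<subseteq> S \<and> lin_indpt A" for A
      using li_le_dim[of A] that S dim_is_n by auto
    show "{} \<subseteq> S \<and> lin_indpt {}" by (auto simp: lin_dep_def)
  qed
  then obtain U where U: "finite U" "maximal U (\<lambda>T. T \<subseteq> S \<and> lin_indpt T)" by blast
  then have US: "U \<subseteq> S" "lin_indpt U" by (auto simp: maximal_def)
  have Uc: "U \<subseteq> carrier_vec n" using US S by blast
  have "card U \<le> n" using li_le_dim(2)[of U] Uc US dim_is_n by auto
  obtain us where us: "set us = U" "length us = card U"
    using finite_distinct_list[OF U(1)] distinct_card by metis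
  \<comment> \<open>Zero vectors are orthogonal to everything, so this padding leaves the complement
    unchanged.\<close>
  define vs where "vs = us @ replicate (n - card U) (0\<^sub>v n)"
  show thesis
  proof
    show "set vs \<subseteq> carrier_vec n" using us Uc by (auto simp: vs_def)
    show "length vs = n" using us \<open>card U \<le> n\<close> by (simp add: vs_def)
    have "orthogonal_complement (set vs) = orthogonal_complement U"
      by (auto simp: vs_def us orthogonal_complement_def)
    also have "\<dots> = orthogonal_complement S"
      by (metis in_orthogonal_complement_span Uc S maximal_lin_indpt_subset_span[OF S U(2)])
    finally show "orthogonal_complement (set vs) = orthogonal_complement S" .
  qed
qed

lemma card_carrier_vec_le:
  "finite (carrier_vec n :: 'f::finite vec set)"
  "card (carrier_vec n :: 'f vec set) \<le> CARD('f) ^ n"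
proof -
  let ?L = "{xs :: 'f list. set xs \<subseteq> UNIV \<and> length xs = n}"
  have L: "finite ?L" "card ?L = CARD('f) ^ n"
    using finite_lists_length_eq[of "UNIV :: 'f set"] card_lists_length_eq[of "UNIV :: 'f set"]
    by auto
  have sub: "(carrier_vec n :: 'f vec set) \<subseteq> vec_of_list ` ?L"
  proof
    fix v :: "'f vec" assume "v \<in> carrier_vec n"
    then show "v \<in> vec_of_list ` ?L"
      by (intro image_eqI[of _ _ "list_of_vec v"]) (auto simp: vec_list)
  qed
  show "finite (carrier_vec n :: 'f vec set)"
    by (rule finite_subset[OF sub finite_imageI[OF L(1)]])
  show "card (carrier_vec n :: 'f vec set) \<le> CARD('f) ^ n"
    using surj_card_le[OF L(1) sub] L(2) by simp
qed

text \<open>Each complement comes from a list of \<open>n\<close> vectors, and each entry has at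
  most \<open>CARD('f) ^ n\<close> values.\<close>

lemma card_orthogonal_complements_le:
  fixes n :: nat
  defines "\<C> \<equiv> vec_module.orthogonal_complement n ` Pow (carrier_vec n :: 'f::{field,finite} vec set)"
  shows "finite \<C>" "card \<C> \<le> CARD('f) ^ (n * n)"
proof -
  interpret vec_space "TYPE('f)" n .
  let ?L = "{vs :: 'f vec list. set vs \<subseteq> carrier_vec n \<and> length vs = n}"
  have sub: "\<C> \<subseteq> (\<lambda>vs. orthogonal_complement (set vs)) ` ?L"
  proof
    fix W assume "W \<in> \<C>"
    then obtain S :: "'f vec set" where "S \<subseteq> carrier_vec n" "W = orthogonal_complement S"
      unfolding \<C>_def by blast
    then show "W \<in> (\<lambda>vs. orthogonal_complement (set vs)) ` ?L"
      by (metis (mono_tags, lifting) orthogonal_complement_of_list imageI mem_Collect_eq)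
  qed
  have fin: "finite ?L" by (rule finite_lists_length_eq[OF card_carrier_vec_le(1)])
  show "finite \<C>" by (rule finite_subset[OF sub finite_imageI[OF fin]])
  have "card \<C> \<le> card ?L" by (rule surj_card_le[OF fin sub])
  also have "\<dots> = card (carrier_vec n :: 'f vec set) ^ n"
    by (rule card_lists_length_eq[OF card_carrier_vec_le(1)])
  also have "\<dots> \<le> (CARD('f) ^ n) ^ n"
    by (intro power_mono card_carrier_vec_le(2)) simp
  finally show "card \<C> \<le> CARD('f) ^ (n * n)" by (simp add: power_mult)
qed

text \<open>Lets arbitrary objects, here subspaces, serve as colours: a bijection renumbers
  \<open>C\<close> by an initial segment of the naturals.\<close>

lemma chromatic_number_le_card:
  assumes "pair_graph G" "finite C" "f ` pverts G \<subseteq> C"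
    and arc: "\<And>x y. (x, y) \<in> parcs G \<Longrightarrow> f x \<noteq> f y"
  shows "chromatic_number G \<le> card C"
proof -
  interpret pair_graph G by fact
  obtain h where h: "bij_betw h C {0..<card C}"
    using ex_bij_betw_finite_nat[OF assms(2)] by blast
  have "proper_coloring G (card C) (h \<circ> f)"
    unfolding proper_coloring_def
  proof (intro conjI ballI, goal_cases)
    case (1 v)
    then show ?case using bij_betwE[OF h] assms(3) by fastforce
  next
    case (2 e)
    then obtain x y where e: "e = (x, y)" "(x, y) \<in> parcs G" by (cases e) auto
    then have "f x \<in> C" "f y \<in> C" using assms(3) wellformed'[OF e(2)] by auto
    then show ?case
      using bij_betw_imp_inj_on[OF h] arc[OF e(2)] e(1) by (auto dest: inj_onD)
  qed
  then show ?thesis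
    unfolding chromatic_number_def by (intro Least_le) blast
qed

lemma arc_underlying_line_graph:
  assumes "(x, y) \<in> parcs G" "(y, z) \<in> parcs G"
  shows "((x, y), (y, z)) \<in> parcs (underlying_line_graph G)"
  using assms by (simp add: underlying_line_graph_def line_digraph_def parcs_mk_symmetric) blast

lemma pverts_underlying_line_graph [simp]: "pverts (underlying_line_graph G) = parcs G"
  by (simp add: underlying_line_graph_def line_digraph_def)

text \<open>The bound without logarithms, for a representation of any dimension \<open>k\<close>,
  minimal or not.\<close>

lemma chromatic_number_le_power:
  fixes u :: "'a \<times> 'a \<Rightarrow> 'f::{field,finite} vec"
  assumes G: "pair_graph G" and u: "orthogonal_representation (underlying_line_graph G) k u"
  shows "chromatic_number G \<le> CARD('f) ^ (k * k)"
proof -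
  interpret vec_space "TYPE('f)" k .
  \<comment> \<open>For an isolated vertex this set is empty and its complement is the whole
    space.\<close>
  define S where "S x = {u (x, y) | y. (x, y) \<in> parcs G}" for x
  have S: "S x \<subseteq> carrier_vec k" for x
    using u by (auto simp: S_def orthogonal_representation_def)
  let ?C = "orthogonal_complement ` Pow (carrier_vec k :: 'f vec set)"
  have "chromatic_number G \<le> card ?C"
  proof (rule chromatic_number_le_card[OF G card_orthogonal_complements_le(1)])
    show "(\<lambda>x. orthogonal_complement (S x)) ` pverts G \<subseteq> ?C" using S by blast
  next
    fix x y assume xy: "(x, y) \<in> parcs G"
    have uxy: "u (x, y) \<in> carrier_vec k" "u (x, y) \<bullet> u (x, y) \<noteq> 0"
      using u xy by (auto simp: orthogonal_representation_def)
    have "u (x, y) \<bullet> u (y, z) = 0" if "(y, z) \<in> parcs G" for z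
      using u arc_underlying_line_graph[OF xy that]
      by (auto simp: orthogonal_representation_def)
    then have "u (x, y) \<in> orthogonal_complement (S y)"
      using uxy by (auto simp: orthogonal_complement_def S_def)
    \<comment> \<open>The vector lies in \<open>S x\<close> and is not self-orthogonal; over a
      finite field, being nonzero would not be enough.\<close>
    moreover have "u (x, y) \<notin> orthogonal_complement (S x)"
      using uxy xy by (auto simp: orthogonal_complement_def S_def)
    ultimately show "orthogonal_complement (S x) \<noteq> orthogonal_complement (S y)" by blast
  qed
  also have "\<dots> \<le> CARD('f) ^ (k * k)" by (rule card_orthogonal_complements_le(2))
  finally show ?thesis .
qed

theorem theorem3p5:
  fixes G :: "'a pair_pre_digraph"
  assumes "pair_graph G"
    and "H = underlying_line_graph G"
  shows "real (orthogonality_dimension TYPE('f::{field,finite}) H)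
           \<ge> sqrt (log (real CARD('f)) (real (chromatic_number G)))"
proof -
  let ?k = "orthogonality_dimension TYPE('f) H" and ?\<chi> = "chromatic_number G"
  have "pair_graph H" using assms pair_graph_underlying_line_graph by blast
  \<comment> \<open>Some representation of \<open>H\<close> exists, so the minimal dimension is
    attained.\<close>
  then have "\<exists>u :: 'a \<times> 'a \<Rightarrow> 'f vec. orthogonal_representation H ?k u"
    unfolding orthogonality_dimension_def
    by (rule LeastI_ex[OF orthogonal_representation_exists])
  then have le: "?\<chi> \<le> CARD('f) ^ (?k * ?k)"
    using chromatic_number_le_power[OF assms(1)] assms(2) by blast
  \<comment> \<open>In a field 0 and 1 differ, so the base of the logarithm exceeds 1 and the
    logarithm is monotone.\<close>
  have "card {0, 1 :: 'f} \<le> CARD('f)" by (intro card_mono) auto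
  then have q: "real CARD('f) > 1" by simp
  have "log (real CARD('f)) (real ?\<chi>) \<le> (real ?k)\<^sup>2"
  proof (cases "?\<chi> = 0")
    case True
    \<comment> \<open>The graph has no vertices; here Isabelle's \<open>log b 0\<close> is \<open>0\<close>.\<close>
    then show ?thesis by (simp add: log_def)
  next
    case False
    have "real ?\<chi> \<le> real CARD('f) ^ (?k * ?k)"
      using le by (metis of_nat_le_iff of_nat_power)
    then have "log (real CARD('f)) (real ?\<chi>) \<le> log (real CARD('f)) (real CARD('f) ^ (?k * ?k))"
      using q False by (intro log_mono) auto
    also have "\<dots> = (real ?k)\<^sup>2"
      using q by (simp add: log_nat_power power2_eq_square)
    finally show ?thesis .
  qed
  then show ?thesis by (intro real_le_lsqrt) auto
qed

end
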